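(* Let $H$ be a hypergraph, $f:V(H)\to(0,\infty)$ a function, and $M_H=(m_{ij})_{i,j\in V(H)}$ a real $f$-symmetric matrix indexed by $V(H)$. For any $\mathfrak{R}_{M_H}$-equivalence class $W$ with $|W|\ge 2$, the vector space $C_W^f$ is an invariant subspace of $M_H$, i.e. $M_Hx\in C_W^f$ for all $x\in C_W^f$.
   Context: A hypergraph $H=(V(H),E(H))$ consists of a finite nonempty vertex set $V(H)$ and a finite family $E(H)$ of nonempty subsets of $V(H)$, called hyperedges. Vectors $x\in\mathbb{R}^{V(H)}$ are functions $x:V(H)\to\mathbb{R}$. For $f:V(H)\to(0,\infty)$, the inner product $(\cdot,\cdot)_f$ on $\mathbb{R}^{V(H)}$ is $(x,y)_f=\sum_{i\in V(H)}f(i)x(i)y(i)$. The matrix $M_H$ is $f$-symmetric if $(M_Hx,y)_f=(x,M_Hy)_f$ for all $x,y\in\mathbb{R}^{V(H)}$. $\mathfrak{R}_{M_H}$ is the equivalence relation on $V(H)$ consisting of the pairs $(i,j)$ such that $m_{ii}=m_{jj}$, $m_{ij}=m_{ji}$, and $m_{ik}=m_{jk}$, $m_{ki}=m_{kj}$ for all $k\notin\{i,j\}$. For $U\subseteq V(H)$, $C^f_U=\{x\in\mathbb{R}^{V(H)}: \text{there is } c_x\in\mathbb{R} \text{ with } f(i)x(i)=c_x \text{ for all } i\in U\}$. *)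

theory Defs
  imports Complex_Main "HOL-Library.Multiset" "HOL-Library.Function_Algebras"
begin

text \<open>The hyperedges form a multiset, since a finite family may contain the same subset several times.\<close>

definition hypergraph :: "'a set \<Rightarrow> 'a set multiset \<Rightarrow> bool" where
  "hypergraph V E \<longleftrightarrow> finite V \<and> V \<noteq> {} \<and> (\<forall>e \<in># E. e \<noteq> {} \<and> e \<subseteq> V)"

text \<open>
  \<open>\<real>\<^sup>V\<close> is rendered as the set of real functions that vanish outside \<open>V\<close>. Each function
  \<open>V \<Rightarrow> \<real>\<close> then has exactly one representative, and \<open>\<real>\<^sup>V\<close> is a subspace of the space of all
  real functions on the type, with pointwise addition and scaling \<open>fscale\<close>.
\<close>

definition fscale :: "real \<Rightarrow> ('a \<Rightarrow> real) \<Rightarrow> 'a \<Rightarrow> real" where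
  "fscale c x = (\<lambda>i. c * x i)"

interpretation fun_space: vector_space fscale
  by unfold_locales (auto simp: fscale_def fun_eq_iff algebra_simps)

definition vecs :: "'a set \<Rightarrow> ('a \<Rightarrow> real) set" where
  "vecs V = {x. \<forall>i. i \<notin> V \<longrightarrow> x i = 0}"

text \<open>Only the entries \<open>M i j\<close> with \<open>i, j \<in> V\<close> of a matrix \<open>M\<close> are ever used.\<close>

definition mat_vec :: "'a set \<Rightarrow> ('a \<Rightarrow> 'a \<Rightarrow> real) \<Rightarrow> ('a \<Rightarrow> real) \<Rightarrow> 'a \<Rightarrow> real" where
  "mat_vec V M x = (\<lambda>i. if i \<in> V then \<Sum>j\<in>V. M i j * x j else 0)"

definition inner_on :: "'a set \<Rightarrow> ('a \<Rightarrow> real) \<Rightarrow> ('a \<Rightarrow> real) \<Rightarrow> ('a \<Rightarrow> real) \<Rightarrow> real" where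
  "inner_on V f x y = (\<Sum>i\<in>V. f i * x i * y i)"

definition f_symmetric :: "'a set \<Rightarrow> ('a \<Rightarrow> real) \<Rightarrow> ('a \<Rightarrow> 'a \<Rightarrow> real) \<Rightarrow> bool" where
  "f_symmetric V f M \<longleftrightarrow>
     (\<forall>x \<in> vecs V. \<forall>y \<in> vecs V. inner_on V f (mat_vec V M x) y = inner_on V f x (mat_vec V M y))"

definition mat_rel :: "'a set \<Rightarrow> ('a \<Rightarrow> 'a \<Rightarrow> real) \<Rightarrow> ('a \<times> 'a) set" where
  "mat_rel V M = {(i, j). i \<in> V \<and> j \<in> V \<and> M i i = M j j \<and> M i j = M j i \<and>
     (\<forall>k \<in> V - {i, j}. M i k = M j k \<and> M k i = M k j)}"

definition const_space :: "'a set \<Rightarrow> ('a \<Rightarrow> real) \<Rightarrow> 'a set \<Rightarrow> ('a \<Rightarrow> real) set" where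
  "const_space V f U = {x \<in> vecs V. \<exists>c. \<forall>i\<in>U. f i * x i = c}"

definition invariant_subspace ::
    "'a set \<Rightarrow> ('a \<Rightarrow> 'a \<Rightarrow> real) \<Rightarrow> ('a \<Rightarrow> real) set \<Rightarrow> bool" where
  "invariant_subspace V M C \<longleftrightarrow>
     fun_space.subspace C \<and> C \<subseteq> vecs V \<and> (\<forall>x \<in> C. mat_vec V M x \<in> C)"

lemma subspace_vecs: "fun_space.subspace (vecs V)"
  by (auto simp: fun_space.subspace_def vecs_def fscale_def)

lemma mat_vec_in_vecs: "mat_vec V M x \<in> vecs V"
  by (simp add: vecs_def mat_vec_def)

lemma equiv_mat_rel: "equiv V (mat_rel V M)"
proof (rule equivI)
  show "mat_rel V M \<subseteq> V \<times> V" "refl_on V (mat_rel V M)" "sym (mat_rel V M)"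
    by (auto simp: mat_rel_def refl_on_def sym_def)
  show "trans (mat_rel V M)"
  proof (rule transI)
    fix i j k assume ij: "(i, j) \<in> mat_rel V M" and jk: "(j, k) \<in> mat_rel V M"
    show "(i, k) \<in> mat_rel V M"
    proof (cases "i = j \<or> j = k \<or> i = k")
      case True
      then show ?thesis using ij jk by (auto simp: mat_rel_def)
    next
      case False
      have V: "i \<in> V" "j \<in> V" "k \<in> V" using ij jk by (auto simp: mat_rel_def)
      have e: "M i k = M j k" "M k i = M k j" "M j k = M k j" "M j i = M k i" "M i j = M i k"
        using ij jk False V by (auto simp: mat_rel_def)
      have "M i l = M k l \<and> M l i = M l k" if "l \<in> V - {i, k}" for l
        using ij jk False e that by (cases "l = j") (auto simp: mat_rel_def)
      then show ?thesis using ij jk e by (auto simp: mat_rel_def)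
    qed
  qed
qed

end

theory Submission
  imports Defs
begin

text \<open>
  Testing \<open>f\<close>-symmetry on unit vectors turns it into the entrywise identity
  \<open>f i * M i j = f j * M j i\<close> (\<open>f_symmetric_entries\<close>): scaling row \<open>i\<close> by \<open>f i\<close> makes \<open>M\<close>
  symmetric. Let \<open>i\<close> and \<open>j\<close> be equivalent, and let \<open>x\<close> satisfy \<open>f i * x i = f j * x j\<close>.
  The claim is that row \<open>i\<close> times \<open>f i\<close> and row \<open>j\<close> times \<open>f j\<close> have the same product with \<open>x\<close>.
  Outside the columns \<open>i\<close> and \<open>j\<close> the two scaled rows even agree: by the scaled symmetry their
  entries in column \<open>k\<close> are \<open>f k * M k i\<close> and \<open>f k * M k j\<close>, and columns \<open>i\<close> and \<open>j\<close> of \<open>M\<close>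
  coincide there. In the columns \<open>i\<close> and \<open>j\<close> the diagonal contributions
  \<open>f i * M i i * x i\<close> and \<open>f j * M j j * x j\<close> agree by the assumption on \<open>x\<close>, and the
  off-diagonal ones agree because \<open>M i j = M j i\<close> forces \<open>f i = f j\<close> unless this entry vanishes
  (\<open>mat_vec_preserves_weighted_equality\<close>).
\<close>

lemma f_symmetric_entries:
  assumes "finite V" "f_symmetric V f M" "i \<in> V" "j \<in> V"
  shows "f i * M i j = f j * M j i"
proof -
  define e where "e a = (\<lambda>k. if k = a then 1 else 0 :: real)" for a :: 'a
  have vec: "e i \<in> vecs V" "e j \<in> vecs V"
    using assms by (auto simp: vecs_def e_def)
  have col: "mat_vec V M (e a) b = M b a" if "a \<in> V" "b \<in> V" for a b
    using assms(1) that by (simp add: mat_vec_def e_def if_distrib[of "\<lambda>t. _ * t"] cong: if_cong)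
  have "inner_on V f (mat_vec V M (e j)) (e i) = f i * M i j"
    using assms by (simp add: inner_on_def e_def[of i] if_distrib[of "\<lambda>t. _ * t"] col cong: if_cong)
  moreover have "inner_on V f (e j) (mat_vec V M (e i)) = f j * M j i"
    using assms
    by (simp add: inner_on_def e_def[of j] if_distrib[of "\<lambda>t. _ * t"]
        if_distrib[of "\<lambda>t. t * _"] col cong: if_cong)
  ultimately show ?thesis
    using assms(2) vec by (auto simp: f_symmetric_def)
qed

lemma subspace_const_space: "fun_space.subspace (const_space V f U)"
proof (rule fun_space.subspaceI)
  show "0 \<in> const_space V f U"
    by (simp add: const_space_def vecs_def)
next
  fix x y assume "x \<in> const_space V f U" "y \<in> const_space V f U"
  then obtain c d where "\<forall>i\<in>U. f i * x i = c" "\<forall>i\<in>U. f i * y i = d" "x \<in> vecs V" "y \<in> vecs V"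
    by (auto simp: const_space_def)
  then have "\<forall>i\<in>U. f i * (x + y) i = c + d" "x + y \<in> vecs V"
    by (simp_all add: vecs_def distrib_left)
  then show "x + y \<in> const_space V f U"
    unfolding const_space_def by blast
next
  fix r x assume "x \<in> const_space V f U"
  then obtain c where "\<forall>i\<in>U. f i * x i = c" "x \<in> vecs V"
    by (auto simp: const_space_def)
  then have "\<forall>i\<in>U. f i * fscale r x i = r * c" "fscale r x \<in> vecs V"
    by (auto simp: vecs_def fscale_def)
  then show "fscale r x \<in> const_space V f U"
    unfolding const_space_def by blast
qed

text \<open>
  This is the invariance of \<open>const_space V f {i, j}\<close> for a single related pair. It suffices for a
  whole class, because \<open>const_space V f W\<close> compares every weighted coordinate in \<open>W\<close> with the one at
  a fixed member of \<open>W\<close>.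
\<close>

lemma mat_vec_preserves_weighted_equality:
  assumes fin: "finite V" and sym: "f_symmetric V f M"
    and rel: "(i, j) \<in> mat_rel V M" and x: "f i * x i = f j * x j"
  shows "f i * mat_vec V M x i = f j * mat_vec V M x j"
proof (cases "i = j")
  case False
  have V: "i \<in> V" "j \<in> V" and diag: "M i i = M j j" and off: "M i j = M j i"
    and cols: "\<And>k. k \<in> V - {i, j} \<Longrightarrow> M k i = M k j"
    using rel by (auto simp: mat_rel_def)
  note entries = f_symmetric_entries[OF fin sym]
  have split: "(\<Sum>k\<in>V. g k) = g i + g j + (\<Sum>k\<in>V - {i, j}. g k)" for g :: "'a \<Rightarrow> real"
    using sum.subset_diff[of "{i, j}" V g] fin V False by simp
  have rest: "f i * M i k * x k = f j * M j k * x k" if "k \<in> V - {i, j}" for k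
    using entries[of i k] entries[of j k] cols[OF that] that V by simp
  have diag': "f i * M i i * x i = f j * M j j * x j"
    using x diag by (metis mult.assoc mult.commute)
  have off': "f i * M i j * x j = f j * M j i * x i"
  proof -
    have f_eq: "f i * M i j = f j * M i j"
      using entries[OF V] off by simp
    then have "f i * M i j * x j = M i j * (f j * x j)"
      by (metis mult.assoc mult.commute)
    also have "\<dots> = M i j * (f i * x i)"
      using x by simp
    also have "\<dots> = f j * M j i * x i"
      using f_eq off by (metis mult.assoc mult.commute)
    finally show ?thesis .
  qed
  have "f i * mat_vec V M x i = (\<Sum>k\<in>V. f i * M i k * x k)"
    using V by (simp add: mat_vec_def sum_distrib_left mult.assoc)
  also have "\<dots> = (\<Sum>k\<in>V. f j * M j k * x k)"
    unfolding split using diag' off' sum.cong[of "V - {i, j}", OF refl rest] by simp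
  also have "\<dots> = f j * mat_vec V M x j"
    using V by (simp add: mat_vec_def sum_distrib_left mult.assoc)
  finally show ?thesis .
qed simp

theorem theorem2p5:
  fixes V :: "'a set" and E :: "'a set multiset"
    and f :: "'a \<Rightarrow> real" and M :: "'a \<Rightarrow> 'a \<Rightarrow> real" and W :: "'a set"
  assumes "hypergraph V E"
    and "\<forall>i \<in> V. f i > 0"
    and "f_symmetric V f M"
    and "W \<in> V // mat_rel V M"
    and "card W \<ge> 2"
  shows "invariant_subspace V M (const_space V f W)"
proof -
  have fin: "finite V"
    using assms(1) by (simp add: hypergraph_def)
  obtain a where W: "W = mat_rel V M `` {a}" and a: "a \<in> V"
    using assms(4) by (rule quotientE)
  have "a \<in> W"
    unfolding W by (rule equiv_class_self[OF equiv_mat_rel a])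
  have "mat_vec V M x \<in> const_space V f W" if x: "x \<in> const_space V f W" for x
  proof -
    have "f i * mat_vec V M x i = f a * mat_vec V M x a" if "i \<in> W" for i
    proof -
      have "f a * x a = f i * x i"
        using x \<open>a \<in> W\<close> that by (auto simp: const_space_def)
      moreover have "(a, i) \<in> mat_rel V M"
        using W that by simp
      ultimately show ?thesis
        by (intro mat_vec_preserves_weighted_equality[OF fin assms(3), symmetric])
    qed
    then show ?thesis
      using mat_vec_in_vecs by (auto simp: const_space_def)
  qed
  then show ?thesis
    by (auto simp: invariant_subspace_def subspace_const_space) (simp add: const_space_def)
qed

end
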